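(* Let $n\ge 2$. The rewriting relation $\rightarrowtail_{\mathrm{full}}$ on head normal forms, generated by the rules below (applied to subterms), is terminating and confluent. Here $x,x'$ range over variables and $y,y_i,z_j$ over head normal forms, and $1\le i\le n$: $(r_2)$ $q(x,y,\dots,y)\rightarrowtail y$; $(r_3)$ $q(x,\mathsf e_1,\dots,\mathsf e_n)\rightarrowtail x$; $(r_4^i)$ $q(x,y_1,\dots,y_{i-1},x,y_{i+1},\dots,y_n)\rightarrowtail q(x,y_1,\dots,y_{i-1},\mathsf e_i,y_{i+1},\dots,y_n)$; $(r_5^i)$ $q(x,y_1,\dots,y_{i-1},q(x,z_1,\dots,z_n),y_{i+1},\dots,y_n)\rightarrowtail q(x,y_1,\dots,y_{i-1},z_i,y_{i+1},\dots,y_n)$; $(r_6^i)$ if $x'<x$: $q(x,y_1,\dots,y_{i-1},q(x',z_1,\dots,z_n),y_{i+1},\dots,y_n)\rightarrowtail q(x',q(x,y_1,\dots,y_{i-1},z_1,y_{i+1},\dots,y_n),\dots,q(x,y_1,\dots,y_{i-1},z_n,y_{i+1},\dots,y_n))$; $(r_7^i)$ if $x'<x$: $q(x,y_1,\dots,y_{i-1},x',y_{i+1},\dots,y_n)\rightarrowtail q(x',q(x,y_1,\dots,y_{i-1},\mathsf e_1,y_{i+1},\dots,y_n),\dots,q(x,y_1,\dots,y_{i-1},\mathsf e_n,y_{i+1},\dots,y_n))$.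
   Context: $\nu_n$ is the type with one $(n+1)$-ary symbol $q$ and constants $\mathsf e_1,\dots,\mathsf e_n$. The variables are $x_1,x_2,x_3,\dots$, totally ordered by $x_1<x_2<x_3<\cdots$. Head normal forms are the $\nu_n$-terms generated by the grammar $t,t_i::=\mathsf e_i\mid x\mid q(x,t_1,\dots,t_n)$ with $x$ a variable (so the first argument of every occurrence of $q$ is a variable). Terminating means there is no infinite rewrite sequence; confluent means any two terms reachable from a common term by rewriting can be rewritten to a common term. *)

theory Defs
  imports Main "HOL-Library.Confluence"
begin

text \<open>All indices are shifted by one so that they agree with list positions: \<open>Var k\<close> is the
  variable \<open>x\<^sub>k\<^sub>+\<^sub>1\<close>, \<open>Cst i\<close> is the constant \<open>e\<^sub>i\<^sub>+\<^sub>1\<close>, and \<open>Q t [t\<^sub>1, ..., t\<^sub>n]\<close> is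
  \<open>q(t, t\<^sub>1, ..., t\<^sub>n)\<close>. The order on variables is the order of their indices.\<close>

datatype trm = Var nat | Cst nat | Q trm "trm list"

inductive_set nu_terms :: "nat \<Rightarrow> trm set" for n :: nat where
  "Var x \<in> nu_terms n"
| "i < n \<Longrightarrow> Cst i \<in> nu_terms n"
| "t \<in> nu_terms n \<Longrightarrow> length ts = n \<Longrightarrow> \<forall>u\<in>set ts. u \<in> nu_terms n \<Longrightarrow> Q t ts \<in> nu_terms n"

inductive_set hnf :: "nat \<Rightarrow> trm set" for n :: nat where
  hnf_Var: "Var x \<in> hnf n"
| hnf_Cst: "i < n \<Longrightarrow> Cst i \<in> hnf n"
| hnf_Q: "length ts = n \<Longrightarrow> \<forall>u\<in>set ts. u \<in> hnf n \<Longrightarrow> Q (Var x) ts \<in> hnf n"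

lemma hnf_nu_terms: "hnf n \<subseteq> nu_terms n"
proof
  fix t assume "t \<in> hnf n"
  then show "t \<in> nu_terms n"
    by induction (auto intro: nu_terms.intros)
qed

definition hnf_args :: "nat \<Rightarrow> trm list \<Rightarrow> bool" where
  "hnf_args n ts \<longleftrightarrow> length ts = n \<and> set ts \<subseteq> hnf n"

text \<open>The entry of \<open>ys\<close> at position \<open>i\<close> is irrelevant in the last four rules, as it is always
  overwritten.\<close>

inductive root_step :: "nat \<Rightarrow> trm \<Rightarrow> trm \<Rightarrow> bool" for n :: nat where
  r2: "y \<in> hnf n \<Longrightarrow> root_step n (Q (Var x) (replicate n y)) y"
| r3: "root_step n (Q (Var x) (map Cst [0..<n])) (Var x)"
| r4: "\<lbrakk>i < n; hnf_args n ys\<rbrakk> \<Longrightarrow>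
    root_step n (Q (Var x) (ys[i := Var x])) (Q (Var x) (ys[i := Cst i]))"
| r5: "\<lbrakk>i < n; hnf_args n ys; hnf_args n zs\<rbrakk> \<Longrightarrow>
    root_step n (Q (Var x) (ys[i := Q (Var x) zs])) (Q (Var x) (ys[i := zs ! i]))"
| r6: "\<lbrakk>i < n; hnf_args n ys; hnf_args n zs; x' < x\<rbrakk> \<Longrightarrow>
    root_step n (Q (Var x) (ys[i := Q (Var x') zs]))
                (Q (Var x') (map (\<lambda>z. Q (Var x) (ys[i := z])) zs))"
| r7: "\<lbrakk>i < n; hnf_args n ys; x' < x\<rbrakk> \<Longrightarrow>
    root_step n (Q (Var x) (ys[i := Var x']))
                (Q (Var x') (map (\<lambda>j. Q (Var x) (ys[i := Cst j])) [0..<n]))"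

text \<open>No closure under the first argument of \<open>Q\<close> is needed: in a head normal form it is a
  variable, and no rule rewrites a variable.\<close>

inductive rw_full :: "nat \<Rightarrow> trm \<Rightarrow> trm \<Rightarrow> bool" for n :: nat where
  rw_root: "root_step n s t \<Longrightarrow> rw_full n s t"
| rw_arg: "\<lbrakk>rw_full n s t; i < n; hnf_args n ys\<rbrakk> \<Longrightarrow>
    rw_full n (Q (Var x) (ys[i := s])) (Q (Var x) (ys[i := t]))"

lemma hnf_Q_iff: "Q (Var x) ts \<in> hnf n \<longleftrightarrow> hnf_args n ts"
  by (auto simp: hnf_args_def intro: hnf_Q elim: hnf.cases)

lemma hnf_args_update: "hnf_args n ys \<Longrightarrow> t \<in> hnf n \<Longrightarrow> hnf_args n (ys[i := t])"
  unfolding hnf_args_def using set_update_subset_insert[of ys i t] by auto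

lemma hnf_args_map:
  "length xs = n \<Longrightarrow> (\<And>x. x \<in> set xs \<Longrightarrow> f x \<in> hnf n) \<Longrightarrow> hnf_args n (map f xs)"
  by (auto simp: hnf_args_def)

lemma root_step_hnf: "root_step n s t \<Longrightarrow> s \<in> hnf n \<and> t \<in> hnf n"
proof (induction rule: root_step.induct)
  case (r2 y x)
  then show ?case by (auto simp: hnf_Q_iff hnf_args_def)
next
  case (r5 i ys zs x)
  then have "zs ! i \<in> hnf n" by (auto simp: hnf_args_def)
  with r5 show ?case by (simp add: hnf_Q_iff hnf_args_update)
next
  case (r6 i ys zs x' x)
  then have "z \<in> hnf n" if "z \<in> set zs" for z using that by (auto simp: hnf_args_def)
  moreover have "length zs = n" using r6 by (simp add: hnf_args_def)
  ultimately show ?case using r6 by (auto simp: hnf_Q_iff intro!: hnf_args_update hnf_args_map)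
qed (auto simp: hnf_Q_iff intro!: hnf_args_update hnf_args_map hnf_Var hnf_Cst)

lemma rw_full_hnf: "rw_full n s t \<Longrightarrow> s \<in> hnf n \<and> t \<in> hnf n"
  by (induction rule: rw_full.induct) (auto simp: root_step_hnf hnf_Q_iff hnf_args_update)

definition terminating :: "('a \<Rightarrow> 'a \<Rightarrow> bool) \<Rightarrow> bool" where
  "terminating R \<longleftrightarrow> \<not> (\<exists>f :: nat \<Rightarrow> 'a. \<forall>k. R (f k) (f (Suc k)))"

end

theory Submission
  imports Defs
begin

text \<open>A variable \<open>x\<close> behaves like \<open>q(x, e\<^sub>1, ..., e\<^sub>n)\<close>, so every head normal form other than a
  constant is a case distinction on its head variable.

  Termination: an Ackermann-like function \<open>A\<^sub>x\<close>, tailored so that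
  \<open>A\<^sub>x (S + 1) > A\<^sub>y (n \<sqdot> A\<^sub>x S)\<close> for \<open>y < x\<close>, interprets \<open>q(x, t\<^sub>1, ..., t\<^sub>n)\<close> as \<open>A\<^sub>x\<close> of the
  sum of the weights of the \<open>t\<^sub>i\<close>; this inequality pays for the duplication in the rules
  \<open>r\<^sub>6\<close> and \<open>r\<^sub>7\<close>, and every step lowers the weight.

  Confluence: evaluate a term under valuations of the variables in \<open>{0, ..., n - 1}\<close>. Rewriting
  preserves the value, and normal forms are reduced ordered decision trees. If two of them compute
  the same function and one has the smaller head variable, or the other is a constant, then the
  other does not depend on that variable, so it agrees with each branch of the first; by induction
  all these branches coincide, which \<open>r\<^sub>2\<close> and \<open>n \<ge> 2\<close> exclude. So the head variables agree, and
  then so do the branches, by induction.\<close>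

section \<open>Terminating and confluent relations\<close>

lemma terminating_iff_wfp: "terminating R \<longleftrightarrow> wfp R\<inverse>\<inverse>"
  by (simp add: terminating_def wfp_def wf_iff_no_infinite_down_chain)

lemma confluentp_if_unique_normal_forms:
  assumes "terminating R" "symp E" "transp E"
    and step: "\<And>s t. R s t \<Longrightarrow> E s t"
    and unique: "\<And>s t. \<lbrakk>E s t; \<nexists>u. R s u; \<nexists>u. R t u\<rbrakk> \<Longrightarrow> s = t"
  shows "confluentp R"
proof (rule confluentpI)
  fix s a b
  assume "R\<^sup>*\<^sup>* s a" "R\<^sup>*\<^sup>* s b"
  have "\<exists>t. R\<^sup>*\<^sup>* s t \<and> (\<nexists>u. R t u)" for s
    using ex_terminating_rtranclp assms(1) unfolding terminating_iff_wfp by metis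
  then obtain a' b' where a': "R\<^sup>*\<^sup>* a a'" "\<nexists>u. R a' u" and b': "R\<^sup>*\<^sup>* b b'" "\<nexists>u. R b' u"
    by metis
  have "s = t \<or> E s t" if "R\<^sup>*\<^sup>* s t" for t
    using that by induction (auto dest: step transpD[OF assms(3)])
  then have "s = a' \<or> E s a'" "s = b' \<or> E s b'"
    using \<open>R\<^sup>*\<^sup>* s a\<close> \<open>R\<^sup>*\<^sup>* s b\<close> a'(1) b'(1) by (meson rtranclp_trans)+
  then have "a' = b' \<or> E a' b'" by (metis assms(2,3) sympD transpD)
  then have "a' = b'" using unique a'(2) b'(2) by blast
  then show "\<exists>c. R\<^sup>*\<^sup>* a c \<and> R\<^sup>*\<^sup>* b c" using a'(1) b'(1) by blast
qed

section \<open>Head normal forms as case distinctions\<close>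

inductive branching :: "nat \<Rightarrow> trm \<Rightarrow> nat \<Rightarrow> trm list \<Rightarrow> bool" for n :: nat where
  branching_Var: "branching n (Var x) x (map Cst [0..<n])"
| branching_Q: "branching n (Q (Var x) ts) x ts"

lemma hnf_cases_branching:
  assumes "t \<in> hnf n"
  obtains (Cst) i where "i < n" "t = Cst i" | (branching) x ts where "branching n t x ts"
  using assms by cases (auto intro: branching.intros)

lemma branching_hnf_args: "branching n t x ts \<Longrightarrow> t \<in> hnf n \<Longrightarrow> hnf_args n ts"
  by (auto simp: hnf_Q_iff hnf_Cst intro!: hnf_args_map elim!: branching.cases)

lemma root_step_same_test:
  assumes "i < n" "hnf_args n ys" "u \<in> hnf n" "branching n u x zs"
  shows "root_step n (Q (Var x) (ys[i := u])) (Q (Var x) (ys[i := zs ! i]))"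
  using assms(4,1-3) by cases (auto simp: hnf_Q_iff dest: root_step.r4 intro: root_step.r5)

lemma root_step_lower_test:
  assumes "i < n" "hnf_args n ys" "u \<in> hnf n" "branching n u y zs" "y < x"
  shows "root_step n (Q (Var x) (ys[i := u])) (Q (Var y) (map (\<lambda>z. Q (Var x) (ys[i := z])) zs))"
  using assms(4,1-3,5)
  by cases (auto simp: hnf_Q_iff comp_def dest: root_step.r7 intro: root_step.r6)

lemma root_step_cases_branching:
  assumes "root_step n s t"
  obtains (equal_args) x where "s = Q (Var x) (replicate n t)"
  | (var) x where "s = Q (Var x) (map Cst [0..<n])" "t = Var x"
  | (same_test) i ys u x zs where "i < n" "hnf_args n ys" "u \<in> hnf n" "branching n u x zs"
      "s = Q (Var x) (ys[i := u])" "t = Q (Var x) (ys[i := zs ! i])"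
  | (lower_test) i ys u y zs x where "i < n" "hnf_args n ys" "u \<in> hnf n" "branching n u y zs"
      "y < x" "s = Q (Var x) (ys[i := u])" "t = Q (Var y) (map (\<lambda>z. Q (Var x) (ys[i := z])) zs)"
  using assms
proof cases
  case r2
  then show ?thesis by (intro equal_args)
next
  case r3
  then show ?thesis by (intro var)
next
  case (r4 i ys x)
  then show ?thesis by (intro same_test[OF _ _ _ branching_Var]) (auto intro: hnf_Var)
next
  case (r5 i ys zs x)
  then show ?thesis by (intro same_test[OF _ _ _ branching_Q]) (auto simp: hnf_Q_iff)
next
  case (r6 i ys zs y x)
  then show ?thesis by (intro lower_test[OF _ _ _ branching_Q]) (auto simp: hnf_Q_iff)
next
  case (r7 i ys y x)
  then show ?thesis by (intro lower_test[OF _ _ _ branching_Var]) (auto intro: hnf_Var)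
qed

section \<open>Termination\<close>

fun ack :: "nat \<Rightarrow> nat \<Rightarrow> nat \<Rightarrow> nat" where
  "ack n 0 s = s + 2"
| "ack n (Suc x) 0 = 2"
| "ack n (Suc x) (Suc s) = Suc (ack n x (n * ack n (Suc x) s))"

lemma ack_ge_add_2: "0 < n \<Longrightarrow> s + 2 \<le> ack n x s"
proof (induction n x s rule: ack.induct)
  case (3 n x s)
  then have "s + 2 \<le> n * ack n (Suc x) s"
    by (metis Suc_leI le_trans mult_le_mono1 nat_mult_1 One_nat_def)
  with 3 show ?case by simp
qed auto

lemma strict_mono_ack:
  assumes "0 < n" shows "strict_mono (ack n x)"
proof (cases x)
  case (Suc y)
  have "ack n x s < ack n x (Suc s)" for s
  proof -
    have "ack n x s \<le> n * ack n x s" using assms by simp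
    also have "\<dots> < ack n x (Suc s)"
      using ack_ge_add_2[OF assms, of "n * ack n x s" y] by (simp add: Suc)
    finally show ?thesis .
  qed
  then show ?thesis by (simp add: strict_mono_Suc_iff)
qed (auto simp: strict_mono_def)

lemmas ack_less_iff = strict_mono_less[OF strict_mono_ack]

lemmas ack_le_iff = strict_mono_less_eq[OF strict_mono_ack]

lemma ack_mono_index:
  assumes "0 < n" "x \<le> y" shows "ack n x s \<le> ack n y s"
proof -
  have "ack n x s \<le> ack n (Suc x) s" for x
  proof (cases s)
    case 0
    then show ?thesis by (cases x) auto
  next
    case (Suc r)
    have "Suc r \<le> ack n (Suc x) r" using ack_ge_add_2[OF assms(1), of r "Suc x"] by simp
    also have "\<dots> \<le> n * ack n (Suc x) r" using assms(1) by simp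
    finally have "ack n x (Suc r) \<le> ack n x (n * ack n (Suc x) r)"
      using assms(1) by (simp add: ack_le_iff)
    then show ?thesis by (simp add: Suc)
  qed
  then show ?thesis using lift_Suc_mono_le[of "\<lambda>x. ack n x s"] assms(2) by blast
qed

lemma ack_mult_ack_less:
  assumes "0 < n" "y < x" "s < t" shows "ack n y (n * ack n x s) < ack n x t"
proof -
  obtain z where x: "x = Suc z" "y \<le> z" using assms(2) by (cases x) auto
  have "ack n y (n * ack n x s) \<le> ack n z (n * ack n x s)"
    using assms(1) x(2) by (rule ack_mono_index)
  also have "\<dots> < ack n x (Suc s)" by (simp add: x)
  also have "\<dots> \<le> ack n x t" using assms by (simp add: ack_le_iff)
  finally show ?thesis .
qed

fun weight :: "nat \<Rightarrow> trm \<Rightarrow> nat" where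
  "weight n (Var x) = 1"
| "weight n (Cst i) = 0"
| "weight n (Q (Var x) ts) = ack n x (\<Sum>t\<leftarrow>ts. weight n t)"
| "weight n (Q _ ts) = 0"

text \<open>The constant filling the hole has weight 0.\<close>

definition context_weight :: "nat \<Rightarrow> trm list \<Rightarrow> nat \<Rightarrow> nat" where
  "context_weight n ys i = (\<Sum>t\<leftarrow>ys[i := Cst 0]. weight n t)"

lemma sum_list_weight_update:
  assumes "i < length ys"
  shows "(\<Sum>t\<leftarrow>ys[i := u]. weight n t) = context_weight n ys i + weight n u"
  using assms by (simp add: context_weight_def upd_conv_take_nth_drop add_ac)

lemma sum_list_weight_branches_less:
  assumes "0 < n" "branching n t x ts"
  shows "(\<Sum>u\<leftarrow>ts. weight n u) < weight n t"
  using assms(2)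
proof cases
  case branching_Q
  then show ?thesis using ack_ge_add_2[OF assms(1), of "\<Sum>u\<leftarrow>ts. weight n u" x] by simp
qed (simp add: comp_def)

lemma weight_branch_less:
  assumes "0 < n" "branching n t x ts" "u \<in> set ts"
  shows "weight n u < weight n t"
proof -
  have "weight n u \<le> (\<Sum>u\<leftarrow>ts. weight n u)" using assms(3) by (intro member_le_sum_list) auto
  also have "\<dots> < weight n t" using assms(1,2) by (rule sum_list_weight_branches_less)
  finally show ?thesis .
qed

lemma weight_lower_test_less:
  assumes "0 < n" "i < length ys" "branching n u y zs" "length zs = n" "y < x"
  shows "weight n (Q (Var y) (map (\<lambda>z. Q (Var x) (ys[i := z])) zs))
    < weight n (Q (Var x) (ys[i := u]))"
proof -
  let ?C = "context_weight n ys i" and ?Z = "\<Sum>z\<leftarrow>zs. weight n z"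
  have "weight n (Q (Var x) (ys[i := z])) \<le> ack n x (?C + ?Z)" if "z \<in> set zs" for z
    using that assms by (simp add: sum_list_weight_update ack_le_iff member_le_sum_list)
  then have "(\<Sum>z\<leftarrow>zs. weight n (Q (Var x) (ys[i := z]))) \<le> (\<Sum>z\<leftarrow>zs. ack n x (?C + ?Z))"
    by (rule sum_list_mono)
  also have "\<dots> = n * ack n x (?C + ?Z)" using assms(4) by (simp add: sum_list_triv)
  finally have "weight n (Q (Var y) (map (\<lambda>z. Q (Var x) (ys[i := z])) zs))
      \<le> ack n y (n * ack n x (?C + ?Z))"
    using assms(1) by (simp add: ack_le_iff comp_def)
  also have "\<dots> < ack n x (?C + weight n u)"
    using assms sum_list_weight_branches_less by (intro ack_mult_ack_less) auto
  finally show ?thesis using assms(2) by (simp add: sum_list_weight_update)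
qed

lemma root_step_weight_less:
  assumes "0 < n" "root_step n s t" shows "weight n t < weight n s"
  using assms(2)
proof (cases rule: root_step_cases_branching)
  case (equal_args x)
  have "weight n t \<le> n * weight n t" using assms(1) by simp
  also have "\<dots> < weight n s"
    using ack_ge_add_2[OF assms(1), of "n * weight n t" x]
    by (simp add: equal_args sum_list_replicate)
  finally show ?thesis .
next
  case (var x)
  then show ?thesis using ack_ge_add_2[OF assms(1), of 0 x] by (simp add: comp_def)
next
  case (same_test i ys u x zs)
  have "hnf_args n zs" using same_test by (blast intro: branching_hnf_args)
  then have "weight n (zs ! i) < weight n u"
    using assms(1) same_test by (intro weight_branch_less) (auto simp: hnf_args_def)
  then show ?thesis
    using assms(1) same_test by (simp add: sum_list_weight_update ack_less_iff hnf_args_def)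
next
  case (lower_test i ys u y zs x)
  have "hnf_args n zs" using lower_test by (blast intro: branching_hnf_args)
  with lower_test have "weight n (Q (Var y) (map (\<lambda>z. Q (Var x) (ys[i := z])) zs))
      < weight n (Q (Var x) (ys[i := u]))"
    using assms(1) by (intro weight_lower_test_less) (auto simp: hnf_args_def)
  then show ?thesis by (simp only: lower_test)
qed

lemma rw_full_weight_less:
  assumes "0 < n" "rw_full n s t" shows "weight n t < weight n s"
  using assms(2)
proof induction
  case (rw_root s t)
  with assms(1) show ?case by (rule root_step_weight_less)
next
  case (rw_arg s t i ys x)
  with assms(1) show ?case
    by (simp add: sum_list_weight_update ack_less_iff hnf_args_def)
qed

lemma terminating_rw_full:
  assumes "0 < n" shows "terminating (rw_full n)"
  unfolding terminating_iff_wfp using rw_full_weight_less[OF assms]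
  by (intro wfp_if_convertible_to_nat[of _ "weight n"]) simp

section \<open>Semantics\<close>

definition valuations :: "nat \<Rightarrow> (nat \<Rightarrow> nat) set" where
  "valuations n = {\<rho>. \<forall>x. \<rho> x < n}"

lemma valuations_less: "\<rho> \<in> valuations n \<Longrightarrow> \<rho> x < n"
  by (simp add: valuations_def)

lemma valuations_update: "\<rho> \<in> valuations n \<Longrightarrow> i < n \<Longrightarrow> \<rho>(x := i) \<in> valuations n"
  by (simp add: valuations_def)

lemma const_in_valuations: "i < n \<Longrightarrow> (\<lambda>_. i) \<in> valuations n"
  by (simp add: valuations_def)

fun sem :: "(nat \<Rightarrow> nat) \<Rightarrow> trm \<Rightarrow> nat" where
  "sem \<rho> (Var x) = \<rho> x"
| "sem \<rho> (Cst i) = i"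
| "sem \<rho> (Q t ts) = map (sem \<rho>) ts ! sem \<rho> t"

lemma sem_branching:
  assumes "branching n t x ts" "t \<in> hnf n" "\<rho> \<in> valuations n"
  shows "sem \<rho> t = sem \<rho> (ts ! \<rho> x)"
  using assms valuations_less[of \<rho> n x]
  by cases (auto simp: hnf_Q_iff hnf_args_def)

lemma root_step_sem:
  assumes "\<rho> \<in> valuations n" "root_step n s t" shows "sem \<rho> s = sem \<rho> t"
  using assms(2)
proof (cases rule: root_step_cases_branching)
  case (same_test i ys u x zs)
  then show ?thesis
    using assms(1) sem_branching[of n u x zs \<rho>]
    by (simp add: nth_list_update hnf_args_def valuations_less)
next
  case (lower_test i ys u y zs x)
  then have "length zs = n" "sem \<rho> u = sem \<rho> (zs ! \<rho> y)"
    using assms(1) branching_hnf_args[of n u y zs] sem_branching[of n u y zs \<rho>]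
    by (auto simp: hnf_args_def)
  moreover from this have "sem \<rho> t = sem \<rho> (Q (Var x) (ys[i := zs ! \<rho> y]))"
    using assms(1) lower_test by (simp add: valuations_less)
  ultimately show ?thesis
    using assms(1) lower_test by (simp add: nth_list_update hnf_args_def valuations_less)
qed (use assms(1) in \<open>simp_all add: valuations_less\<close>)

lemma rw_full_sem:
  assumes "\<rho> \<in> valuations n" "rw_full n s t" shows "sem \<rho> s = sem \<rho> t"
  using assms(2)
proof induction
  case (rw_root s t)
  with assms(1) show ?case by (rule root_step_sem)
next
  case (rw_arg s t i ys x)
  then show ?case by (simp add: map_update)
qed

definition same_sem :: "nat \<Rightarrow> trm \<Rightarrow> trm \<Rightarrow> bool" where
  "same_sem n s t \<longleftrightarrow> s \<in> hnf n \<and> t \<in> hnf n \<and> (\<forall>\<rho>\<in>valuations n. sem \<rho> s = sem \<rho> t)"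

lemma same_sem_sem: "same_sem n s t \<Longrightarrow> \<rho> \<in> valuations n \<Longrightarrow> sem \<rho> s = sem \<rho> t"
  by (simp add: same_sem_def)

lemma symp_same_sem: "symp (same_sem n)"
  by (auto simp: same_sem_def intro: sympI)

lemma transp_same_sem: "transp (same_sem n)"
  by (auto simp: same_sem_def intro: transpI)

lemma rw_full_same_sem: "rw_full n s t \<Longrightarrow> same_sem n s t"
  by (simp add: same_sem_def rw_full_hnf rw_full_sem)

section \<open>Normal forms\<close>

definition normal :: "nat \<Rightarrow> trm \<Rightarrow> bool" where
  "normal n t \<longleftrightarrow> t \<in> hnf n \<and> (\<nexists>u. rw_full n t u)"

lemma normal_hnf: "normal n t \<Longrightarrow> t \<in> hnf n"
  by (simp add: normal_def)

lemma normal_not_root_step: "normal n t \<Longrightarrow> \<not> root_step n t u"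
  by (auto simp: normal_def intro: rw_root)

lemma normal_Cst: "i < n \<Longrightarrow> normal n (Cst i)"
  by (auto simp: normal_def hnf_Cst elim: rw_full.cases root_step.cases)

lemma normal_hnf_args: "normal n t \<Longrightarrow> branching n t x ts \<Longrightarrow> hnf_args n ts"
  by (blast intro: branching_hnf_args normal_hnf)

definition root_above :: "nat \<Rightarrow> nat \<Rightarrow> trm \<Rightarrow> bool" where
  "root_above n x t \<longleftrightarrow> (\<forall>y ts. branching n t y ts \<longrightarrow> x < y)"

lemma root_above_Cst: "root_above n x (Cst i)"
  by (auto simp: root_above_def elim: branching.cases)

lemma root_above_branching: "branching n t y ts \<Longrightarrow> root_above n x t \<longleftrightarrow> x < y"
  by (auto simp: root_above_def elim!: branching.cases intro: branching.intros)

lemma root_above_trans: "root_above n y t \<Longrightarrow> x < y \<Longrightarrow> root_above n x t"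
  unfolding root_above_def by (meson less_trans)

lemma normal_branch:
  assumes "normal n t" "branching n t x ts" "u \<in> set ts"
  shows "normal n u"
  using assms(2)
proof cases
  case branching_Var
  then show ?thesis using assms(3) by (auto intro: normal_Cst)
next
  case branching_Q
  have args: "hnf_args n ts" using assms(1,2) by (rule normal_hnf_args)
  obtain i where i: "i < n" "ts ! i = u"
    using assms(3) args by (auto simp: hnf_args_def in_set_conv_nth)
  have "\<not> rw_full n u v" for v
    using rw_arg[OF _ i(1) args, of u v x] assms(1) i branching_Q by (auto simp: normal_def)
  then show ?thesis using assms(3) args by (auto simp: normal_def hnf_args_def)
qed

lemma length_branches: "normal n t \<Longrightarrow> branching n t x ts \<Longrightarrow> length ts = n"
  using normal_hnf_args by (simp add: hnf_args_def)

lemma normal_nth_branch: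
  assumes "normal n t" "branching n t x ts" "i < n"
  shows "normal n (ts ! i)"
  using assms(1,2) by (rule normal_branch) (use length_branches[OF assms(1,2)] assms(3) in simp)

lemma normal_branch_root_above:
  assumes "normal n t" "branching n t x ts" "u \<in> set ts"
  shows "root_above n x u"
  using assms(2)
proof cases
  case branching_Var
  then show ?thesis using assms(3) by (auto intro: root_above_Cst)
next
  case branching_Q
  have args: "hnf_args n ts" using assms(1,2) by (rule normal_hnf_args)
  obtain i where i: "i < n" "ts ! i = u"
    using assms(3) args by (auto simp: hnf_args_def in_set_conv_nth)
  then have t: "t = Q (Var x) (ts[i := u])" using branching_Q by auto
  have u: "u \<in> hnf n" using assms(3) args by (auto simp: hnf_args_def)
  show ?thesis unfolding root_above_def
  proof (intro allI impI)
    fix y zs assume y: "branching n u y zs"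
    have "y \<noteq> x"
      using root_step_same_test[OF i(1) args u] y normal_not_root_step[OF assms(1)] t by blast
    moreover have "\<not> y < x"
      using root_step_lower_test[OF i(1) args u y] normal_not_root_step[OF assms(1)] t by blast
    ultimately show "x < y" by simp
  qed
qed

lemma normal_branches_not_constant:
  assumes "n \<ge> 2" "normal n t" "branching n t x ts"
  shows "ts \<noteq> replicate n u"
proof
  assume ts: "ts = replicate n u"
  from assms(3) show False
  proof cases
    case branching_Var
    then have "ts ! 0 = Cst 0" "ts ! 1 = Cst 1" using assms(1) by simp_all
    then show False using ts assms(1) by simp
  next
    case branching_Q
    have "u \<in> hnf n" using normal_hnf_args[OF assms(2,3)] ts assms(1) by (auto simp: hnf_args_def)
    then show False using normal_not_root_step[OF assms(2)] root_step.r2 branching_Q ts by blast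
  qed
qed

lemma normal_eq_if_same_branching:
  assumes "normal n s" "normal n t" "branching n s x ts" "branching n t x ts"
  shows "s = t"
proof -
  have "\<not> root_step n s (Var x)" "\<not> root_step n t (Var x)"
    using assms(1,2) by (simp_all add: normal_not_root_step)
  then show ?thesis using assms(3,4) root_step.r3[of n x] by (auto elim!: branching.cases)
qed

lemma sem_update_below_root:
  assumes "normal n t" "root_above n x t" "\<rho> \<in> valuations n" "i < n"
  shows "sem (\<rho>(x := i)) t = sem \<rho> t"
  using assms(1,2)
proof (induction "weight n t" arbitrary: t rule: less_induct)
  case less
  have t: "t \<in> hnf n" using less.prems(1) by (rule normal_hnf)
  then show ?case
  proof (cases rule: hnf_cases_branching)
    case (branching y ts)
    have "x < y" using branching less.prems(2) by (simp add: root_above_branching)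
    let ?u = "ts ! \<rho> y"
    have u: "?u \<in> set ts"
      using length_branches[OF less.prems(1) branching] assms(3) by (simp add: valuations_less)
    have "sem (\<rho>(x := i)) ?u = sem \<rho> ?u"
    proof (rule less.hyps)
      show "weight n ?u < weight n t" using assms(4) branching u by (intro weight_branch_less) auto
      show "normal n ?u" using less.prems(1) branching u by (rule normal_branch)
      show "root_above n x ?u"
        using normal_branch_root_above[OF less.prems(1) branching u] \<open>x < y\<close>
        by (rule root_above_trans)
    qed
    moreover have "sem (\<rho>(x := i)) t = sem (\<rho>(x := i)) ?u"
      using sem_branching[OF branching t valuations_update[OF assms(3,4), of x]] \<open>x < y\<close> by simp
    moreover have "sem \<rho> t = sem \<rho> ?u" using branching t assms(3) by (rule sem_branching)
    ultimately show ?thesis by simp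
  qed simp
qed

lemma sem_update_root:
  assumes "normal n t" "branching n t x ts" "\<rho> \<in> valuations n" "i < n"
  shows "sem (\<rho>(x := i)) t = sem \<rho> (ts ! i)"
proof -
  have "root_above n x (ts ! i)"
    using assms(1,2) length_branches[OF assms(1,2)] assms(4)
    by (intro normal_branch_root_above[of n t]) auto
  with normal_nth_branch[OF assms(1,2,4)]
  have "sem (\<rho>(x := i)) (ts ! i) = sem \<rho> (ts ! i)"
    using assms(3,4) by (rule sem_update_below_root)
  moreover have "sem (\<rho>(x := i)) t = sem (\<rho>(x := i)) (ts ! i)"
    using sem_branching[OF assms(2) normal_hnf[OF assms(1)] valuations_update[OF assms(3,4)]]
    by simp
  ultimately show ?thesis by simp
qed

lemma sem_branch_if_same_sem:
  assumes "normal n s" "branching n s x ss" "same_sem n s t" "\<rho> \<in> valuations n" "i < n"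
  shows "sem \<rho> (ss ! i) = sem (\<rho>(x := i)) t"
proof -
  have "sem \<rho> (ss ! i) = sem (\<rho>(x := i)) s"
    using assms(1,2,4,5) by (rule sem_update_root[symmetric])
  also have "\<dots> = sem (\<rho>(x := i)) t"
    using assms(3) valuations_update[OF assms(4,5)] by (rule same_sem_sem)
  finally show ?thesis .
qed

lemma same_sem_branches:
  assumes "normal n s" "branching n s x ss" "normal n t" "branching n t x ts"
    and "same_sem n s t" "i < n"
  shows "same_sem n (ss ! i) (ts ! i)"
proof -
  have "sem \<rho> (ss ! i) = sem \<rho> (ts ! i)" if "\<rho> \<in> valuations n" for \<rho>
    using sem_branch_if_same_sem[OF assms(1,2,5) that assms(6)]
      sem_update_root[OF assms(3,4) that assms(6)] by simp
  moreover have "ss ! i \<in> hnf n" "ts ! i \<in> hnf n"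
    using normal_nth_branch[OF assms(1,2,6)] normal_nth_branch[OF assms(3,4,6)]
    by (simp_all add: normal_hnf)
  ultimately show ?thesis by (simp add: same_sem_def)
qed

lemma same_sem_branch_if_root_above:
  assumes "normal n s" "branching n s x ss" "normal n t" "root_above n x t"
    and "same_sem n s t" "i < n"
  shows "same_sem n (ss ! i) t"
proof -
  have "sem \<rho> (ss ! i) = sem \<rho> t" if "\<rho> \<in> valuations n" for \<rho>
    using sem_branch_if_same_sem[OF assms(1,2,5) that assms(6)]
      sem_update_below_root[OF assms(3,4) that assms(6)] by simp
  moreover have "ss ! i \<in> hnf n" "t \<in> hnf n"
    using normal_nth_branch[OF assms(1,2,6)] assms(3) by (simp_all add: normal_hnf)
  ultimately show ?thesis by (simp add: same_sem_def)
qed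

lemma not_same_sem_if_root_above:
  assumes "n \<ge> 2" "normal n s" "branching n s x ss" "normal n t" "root_above n x t"
    and smaller: "\<And>u. \<lbrakk>normal n u; weight n u < weight n s; same_sem n u t\<rbrakk> \<Longrightarrow> u = t"
  shows "\<not> same_sem n s t"
proof
  assume "same_sem n s t"
  have len: "length ss = n" using assms(2,3) by (rule length_branches)
  have "ss ! i = t" if "i < n" for i
  proof (rule smaller)
    show "normal n (ss ! i)" using assms(2,3) that by (rule normal_nth_branch)
    show "weight n (ss ! i) < weight n s"
      using assms(1,3) that len by (intro weight_branch_less) auto
    show "same_sem n (ss ! i) t"
      using assms(2-5) \<open>same_sem n s t\<close> that by (rule same_sem_branch_if_root_above)
  qed
  then have "ss = replicate n t" using len by (simp add: list_eq_iff_nth_eq)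
  then show False using normal_branches_not_constant[OF assms(1-3)] by simp
qed

lemma normal_eq_if_same_root:
  assumes "normal n s" "branching n s x ss" "normal n t" "branching n t x ts" "same_sem n s t"
    and smaller: "\<And>u v. \<lbrakk>normal n u; normal n v; weight n u < weight n s; weight n v < weight n t;
      same_sem n u v\<rbrakk> \<Longrightarrow> u = v"
  shows "s = t"
proof -
  have len: "length ss = n" "length ts = n"
    using length_branches[OF assms(1,2)] length_branches[OF assms(3,4)] .
  have "ss ! i = ts ! i" if "i < n" for i
  proof (rule smaller)
    show "normal n (ss ! i)" using assms(1,2) that by (rule normal_nth_branch)
    show "normal n (ts ! i)" using assms(3,4) that by (rule normal_nth_branch)
    show "weight n (ss ! i) < weight n s" "weight n (ts ! i) < weight n t"
      using weight_branch_less[of n s x ss "ss ! i"] weight_branch_less[of n t x ts "ts ! i"]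
        assms(2,4) that len by auto
    show "same_sem n (ss ! i) (ts ! i)" using assms(1-5) that by (rule same_sem_branches)
  qed
  then have "ss = ts" using len by (simp add: list_eq_iff_nth_eq)
  then show ?thesis using normal_eq_if_same_branching assms(1-4) by blast
qed

lemma root_comparison_cases:
  assumes "s \<in> hnf n" "t \<in> hnf n"
  obtains (Cst) i j where "s = Cst i" "t = Cst j"
  | (same) x ss ts where "branching n s x ss" "branching n t x ts"
  | (left) x ss where "branching n s x ss" "root_above n x t"
  | (right) x ts where "branching n t x ts" "root_above n x s"
  using assms(1)
proof (cases rule: hnf_cases_branching)
  case s: (Cst i)
  from assms(2) show ?thesis
    by (cases rule: hnf_cases_branching) (auto intro: Cst right simp: s root_above_Cst)
next
  case s: (branching x ss)
  from assms(2) show ?thesis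
  proof (cases rule: hnf_cases_branching)
    case (Cst j)
    then show ?thesis using s left root_above_Cst by blast
  next
    case t: (branching y ts)
    consider "x = y" | "x < y" | "y < x" by linarith
    then show ?thesis
      using s t same left right root_above_branching by cases metis+
  qed
qed

lemma normal_eq_if_same_sem:
  assumes "n \<ge> 2" "normal n s" "normal n t" "same_sem n s t"
  shows "s = t"
  using assms(2-)
proof (induction "weight n s + weight n t" arbitrary: s t rule: less_induct)
  case less
  from less.prems(1,2)[THEN normal_hnf] show ?case
  proof (cases rule: root_comparison_cases)
    case (Cst i j)
    have "(\<lambda>_. 0) \<in> valuations n" using assms(1) by (intro const_in_valuations) simp
    then show ?thesis using same_sem_sem[OF less.prems(3)] Cst by simp
  next
    case (same x ss ts)
    from less.prems(1) same(1) less.prems(2) same(2) less.prems(3) show ?thesis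
      by (rule normal_eq_if_same_root) (simp add: less.hyps add_strict_mono)
  next
    case (left x ss)
    from assms(1) less.prems(1) left(1) less.prems(2) left(2) have "\<not> same_sem n s t"
      by (rule not_same_sem_if_root_above) (simp add: less.hyps less.prems(2))
    then show ?thesis using less.prems(3) by simp
  next
    case (right x ts)
    from assms(1) less.prems(2) right(1) less.prems(1) right(2) have "\<not> same_sem n t s"
      by (rule not_same_sem_if_root_above) (simp add: less.hyps less.prems(1))
    then show ?thesis using sympD[OF symp_same_sem less.prems(3)] by simp
  qed
qed

theorem theorem7p12:
  fixes n :: nat
  assumes "n \<ge> 2"
  shows "terminating (rw_full n) \<and> confluentp (rw_full n)"
proof
  show terminating: "terminating (rw_full n)" using assms by (intro terminating_rw_full) simp
  from terminating symp_same_sem[of n] transp_same_sem[of n] rw_full_same_sem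
  show "confluentp (rw_full n)"
  proof (rule confluentp_if_unique_normal_forms)
    fix s t
    assume same: "same_sem n s t" and "\<nexists>u. rw_full n s u" "\<nexists>u. rw_full n t u"
    then have "normal n s" "normal n t" by (auto simp: normal_def same_sem_def)
    with assms show "s = t" using same by (rule normal_eq_if_same_sem)
  qed
qed

end
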